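(* In the theory $\mathsf{ZF}$ (Zermelo–Fraenkel set theory without the Axiom of Choice), the following two statements are equivalent: (1) the Axiom of Choice; (2) for every semi-separative Zorn partial order $\mathbb P$ and every family $\mathcal D$ of dense subsets of $\mathbb P$ (with no restriction on $\mathcal D$), there exists a $\mathcal D$-generic filter $G\subseteq\mathbb P$.
   Context: The Axiom of Choice is the statement that every family of nonempty sets has a choice function. Let $\mathbb P$ be a partially ordered set with order $\leq$; $p$ extends $q$ if $p\leq q$. Two elements $p,q\in\mathbb P$ are compatible if there exists $r\in\mathbb P$ with $r\leq p$ and $r\leq q$; otherwise they are incompatible. $\mathbb P$ is semi-separative if for every $p\in\mathbb P$, either $p$ is minimal or $p$ has two incompatible extensions in $\mathbb P$. $\mathbb P$ is a Zorn partial order if every linearly ordered subset of $\mathbb P$ (including the empty one) has a lower bound in $\mathbb P$. A subset $D\subseteq\mathbb P$ is dense if for every $p\in\mathbb P$ there is $q\in D$ with $q\leq p$. A subset $G\subseteq\mathbb P$ is a filter if it is closed upwards ($p\in G$ and $p\leq q$ imply $q\in G$) and for all $p,q\in G$ there exists $r\in G$ with $r\leq p$ and $r\leq q$. A filter $G$ is $\mathcal D$-generic if $G\cap D\neq\varnothing$ for every $D\in\mathcal D$. *)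

theory Defs
  imports Main
begin

text \<open>
  The theorem is about first-order \<open>ZF\<close>, and the surrounding logic has a choice operator.  The
  equivalence is therefore stated for an arbitrary structure \<open>('v, mem)\<close> satisfying the \<open>ZF\<close>
  axioms, and both of its sides are evaluated inside that structure.  Every notion below
  quantifies over elements of \<open>'v\<close> only, so that each is the interpretation of a first-order
  formula in the language of set theory.

  The Separation and Replacement schemas must range over first-order formulas: instantiated
  with all predicates on \<open>'v\<close> they would make the axiom of choice true in the structure.
  Hence the formulas of the language are given as a datatype.
\<close>

datatype fm =
    Member nat nat
  | Equal nat nat
  | Neg fm
  | Conj fm fm
  | Forall nat fm

locale membership_structure =
  fixes mem :: "'v \<Rightarrow> 'v \<Rightarrow> bool"  (infix "\<^bold>\<in>" 50)
begin

primrec sat :: "fm \<Rightarrow> (nat \<Rightarrow> 'v) \<Rightarrow> bool" where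
  "sat (Member i j) s \<longleftrightarrow> s i \<^bold>\<in> s j"
| "sat (Equal i j) s \<longleftrightarrow> s i = s j"
| "sat (Neg \<phi>) s \<longleftrightarrow> \<not> sat \<phi> s"
| "sat (Conj \<phi> \<psi>) s \<longleftrightarrow> sat \<phi> s \<and> sat \<psi> s"
| "sat (Forall i \<phi>) s \<longleftrightarrow> (\<forall>a. sat \<phi> (s(i := a)))"

definition subset :: "'v \<Rightarrow> 'v \<Rightarrow> bool" where
  "subset a b \<longleftrightarrow> (\<forall>x. x \<^bold>\<in> a \<longrightarrow> x \<^bold>\<in> b)"

definition is_empty :: "'v \<Rightarrow> bool" where
  "is_empty a \<longleftrightarrow> (\<forall>x. \<not> x \<^bold>\<in> a)"

definition is_succ :: "'v \<Rightarrow> 'v \<Rightarrow> bool" where \<comment> \<open>\<open>b = a \<union> {a}\<close>\<close>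
  "is_succ b a \<longleftrightarrow> (\<forall>x. x \<^bold>\<in> b \<longleftrightarrow> x \<^bold>\<in> a \<or> x = a)"

definition is_upair :: "'v \<Rightarrow> 'v \<Rightarrow> 'v \<Rightarrow> bool" where \<comment> \<open>\<open>u = {a, b}\<close>\<close>
  "is_upair u a b \<longleftrightarrow> (\<forall>x. x \<^bold>\<in> u \<longleftrightarrow> x = a \<or> x = b)"

definition is_pair :: "'v \<Rightarrow> 'v \<Rightarrow> 'v \<Rightarrow> bool" where \<comment> \<open>Kuratowski: \<open>u = {{a}, {a, b}}\<close>\<close>
  "is_pair u a b \<longleftrightarrow> (\<exists>v w. is_upair v a a \<and> is_upair w a b \<and> is_upair u v w)"


subsection \<open>The axioms of ZF\<close>

definition extensionality :: bool where
  "extensionality \<longleftrightarrow> (\<forall>a b. (\<forall>x. x \<^bold>\<in> a \<longleftrightarrow> x \<^bold>\<in> b) \<longrightarrow> a = b)"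

definition foundation :: bool where
  "foundation \<longleftrightarrow>
     (\<forall>a. \<not> is_empty a \<longrightarrow> (\<exists>x. x \<^bold>\<in> a \<and> \<not> (\<exists>y. y \<^bold>\<in> x \<and> y \<^bold>\<in> a)))"

definition pairing :: bool where
  "pairing \<longleftrightarrow> (\<forall>a b. \<exists>u. is_upair u a b)"

definition union :: bool where
  "union \<longleftrightarrow> (\<forall>a. \<exists>b. \<forall>x. x \<^bold>\<in> b \<longleftrightarrow> (\<exists>y. y \<^bold>\<in> a \<and> x \<^bold>\<in> y))"

definition power_set :: bool where
  "power_set \<longleftrightarrow> (\<forall>a. \<exists>b. \<forall>x. x \<^bold>\<in> b \<longleftrightarrow> subset x a)"

definition infinity :: bool where
  "infinity \<longleftrightarrow>
     (\<exists>w. (\<exists>e. is_empty e \<and> e \<^bold>\<in> w) \<and>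
          (\<forall>x. x \<^bold>\<in> w \<longrightarrow> (\<exists>y. is_succ y x \<and> y \<^bold>\<in> w)))"

text \<open>
  In an instance of a schema, variable \<open>0\<close> (and for Replacement variable \<open>1\<close>) is the
  argument of the formula; the values \<open>s\<close> assigns to the other variables are its parameters.
\<close>

definition separation :: bool where
  "separation \<longleftrightarrow>
     (\<forall>\<phi> s a. \<exists>b. \<forall>x. x \<^bold>\<in> b \<longleftrightarrow> x \<^bold>\<in> a \<and> sat \<phi> (s(0 := x)))"

definition replacement :: bool where
  "replacement \<longleftrightarrow>
     (\<forall>\<phi> s a.
        (\<forall>x y z. x \<^bold>\<in> a \<and> sat \<phi> (s(0 := x, 1 := y)) \<and> sat \<phi> (s(0 := x, 1 := z)) \<longrightarrow> y = z) \<longrightarrow>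
        (\<exists>b. \<forall>y. y \<^bold>\<in> b \<longleftrightarrow> (\<exists>x. x \<^bold>\<in> a \<and> sat \<phi> (s(0 := x, 1 := y)))))"

definition ZF :: bool where
  "ZF \<longleftrightarrow> extensionality \<and> foundation \<and> pairing \<and> union \<and> power_set \<and> infinity
       \<and> separation \<and> replacement"


subsection \<open>The axiom of choice\<close>

definition related :: "'v \<Rightarrow> 'v \<Rightarrow> 'v \<Rightarrow> bool" where \<comment> \<open>\<open>(x, y) \<in> r\<close>\<close>
  "related r x y \<longleftrightarrow> (\<exists>u. u \<^bold>\<in> r \<and> is_pair u x y)"

definition function_on :: "'v \<Rightarrow> 'v \<Rightarrow> bool" where \<comment> \<open>\<open>f\<close> is a function with domain \<open>a\<close>\<close>
  "function_on f a \<longleftrightarrow>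
     (\<forall>u. u \<^bold>\<in> f \<longrightarrow> (\<exists>x y. x \<^bold>\<in> a \<and> is_pair u x y)) \<and>
     (\<forall>x. x \<^bold>\<in> a \<longrightarrow> (\<exists>!y. related f x y))"

definition choice_function :: "'v \<Rightarrow> 'v \<Rightarrow> bool" where
  "choice_function f F \<longleftrightarrow>
     function_on f F \<and> (\<forall>X y. X \<^bold>\<in> F \<and> related f X y \<longrightarrow> y \<^bold>\<in> X)"

definition AC :: bool where
  "AC \<longleftrightarrow> (\<forall>F. (\<forall>X. X \<^bold>\<in> F \<longrightarrow> \<not> is_empty X) \<longrightarrow> (\<exists>f. choice_function f F))"


subsection \<open>Partial orders, dense sets and generic filters\<close>

text \<open>A partial order is a pair of sets \<open>P\<close>, \<open>R\<close>; \<open>related R p q\<close> is \<open>p \<le> q\<close>.\<close>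

definition partial_order :: "'v \<Rightarrow> 'v \<Rightarrow> bool" where
  "partial_order P R \<longleftrightarrow>
     (\<forall>u. u \<^bold>\<in> R \<longrightarrow> (\<exists>p q. p \<^bold>\<in> P \<and> q \<^bold>\<in> P \<and> is_pair u p q)) \<and>
     (\<forall>p. p \<^bold>\<in> P \<longrightarrow> related R p p) \<and>
     (\<forall>p q. related R p q \<and> related R q p \<longrightarrow> p = q) \<and>
     (\<forall>p q r. related R p q \<and> related R q r \<longrightarrow> related R p r)"

definition compatible :: "'v \<Rightarrow> 'v \<Rightarrow> 'v \<Rightarrow> 'v \<Rightarrow> bool" where
  "compatible P R p q \<longleftrightarrow> (\<exists>r. r \<^bold>\<in> P \<and> related R r p \<and> related R r q)"

definition minimal :: "'v \<Rightarrow> 'v \<Rightarrow> 'v \<Rightarrow> bool" where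
  "minimal P R p \<longleftrightarrow> p \<^bold>\<in> P \<and> (\<forall>q. q \<^bold>\<in> P \<and> related R q p \<longrightarrow> q = p)"

definition semi_separative :: "'v \<Rightarrow> 'v \<Rightarrow> bool" where
  "semi_separative P R \<longleftrightarrow>
     (\<forall>p. p \<^bold>\<in> P \<longrightarrow>
        minimal P R p \<or>
        (\<exists>q r. q \<^bold>\<in> P \<and> r \<^bold>\<in> P \<and> related R q p \<and> related R r p \<and> \<not> compatible P R q r))"

definition linearly_ordered :: "'v \<Rightarrow> 'v \<Rightarrow> bool" where
  "linearly_ordered R C \<longleftrightarrow>
     (\<forall>p q. p \<^bold>\<in> C \<and> q \<^bold>\<in> C \<longrightarrow> related R p q \<or> related R q p)"

definition Zorn_order :: "'v \<Rightarrow> 'v \<Rightarrow> bool" where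
  "Zorn_order P R \<longleftrightarrow>
     (\<forall>C. subset C P \<and> linearly_ordered R C \<longrightarrow>
        (\<exists>b. b \<^bold>\<in> P \<and> (\<forall>c. c \<^bold>\<in> C \<longrightarrow> related R b c)))"

definition dense :: "'v \<Rightarrow> 'v \<Rightarrow> 'v \<Rightarrow> bool" where
  "dense P R D \<longleftrightarrow>
     subset D P \<and> (\<forall>p. p \<^bold>\<in> P \<longrightarrow> (\<exists>q. q \<^bold>\<in> D \<and> related R q p))"

definition is_filter :: "'v \<Rightarrow> 'v \<Rightarrow> 'v \<Rightarrow> bool" where
  "is_filter P R G \<longleftrightarrow>
     subset G P \<and>
     (\<forall>p q. p \<^bold>\<in> G \<and> q \<^bold>\<in> P \<and> related R p q \<longrightarrow> q \<^bold>\<in> G) \<and>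
     (\<forall>p q. p \<^bold>\<in> G \<and> q \<^bold>\<in> G \<longrightarrow> (\<exists>r. r \<^bold>\<in> G \<and> related R r p \<and> related R r q))"

definition generic_filter :: "'v \<Rightarrow> 'v \<Rightarrow> 'v \<Rightarrow> 'v \<Rightarrow> bool" where
  "generic_filter P R \<D> G \<longleftrightarrow>
     is_filter P R G \<and> (\<forall>D. D \<^bold>\<in> \<D> \<longrightarrow> (\<exists>p. p \<^bold>\<in> G \<and> p \<^bold>\<in> D))"

definition generic_filters_exist :: bool where
  "generic_filters_exist \<longleftrightarrow>
     (\<forall>P R \<D>.
        partial_order P R \<and> semi_separative P R \<and> Zorn_order P R \<and>
        (\<forall>D. D \<^bold>\<in> \<D> \<longrightarrow> dense P R D) \<longrightarrow>
        (\<exists>G. generic_filter P R \<D> G))"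

end

end

theory Submission
  imports Defs
begin

text \<open>
  If choice holds, Zorn's lemma inside the structure yields a minimal element, and the filter of
  all elements above it meets every dense set.

  Conversely, for a family \<open>F\<close> of nonempty sets let \<open>E = {(X, x). x \<in> X \<in> F}\<close> and order by inclusion
  the subrelations \<open>p\<close> of \<open>E\<close> whose fibre over each \<open>X \<in> F\<close> is either all of \<open>X\<close> or a singleton.
  Intersections bound chains from below, and whenever a fibre is not a singleton it can be shrunk
  to two different ones; thus the order is a semi-separative Zorn order also when \<open>F\<close> contains
  singletons, for which partial choice functions would fail.  The intersection of a filter meeting
  the dense sets \<open>{p. the fibre of p over X is a singleton}\<close> is a choice function.

  Zorn's lemma is proved by comparing conforming chains, which avoids ordinals and recursion: only
  sets obtained by Separation are needed.
\<close>

section \<open>Choosing strict upper bounds of chains\<close>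

text \<open>\<open>\<S>\<close> stands for those collections that are sets of a given structure. It
  is closed only under operations that Separation and adding one point provide, so the argument
  cannot leave the structure.\<close>

locale bounded_chain_choice =
  fixes P :: "'a set" and less :: "'a \<Rightarrow> 'a \<Rightarrow> bool"  (infix "\<sqsubset>" 50)
    and \<S> :: "'a set set" and h :: "'a set \<Rightarrow> 'a"
  assumes irrefl: "\<not> x \<sqsubset> x"
    and trans: "x \<sqsubset> y \<Longrightarrow> y \<sqsubset> z \<Longrightarrow> x \<sqsubset> z"
    and Int_closed: "A \<in> \<S> \<Longrightarrow> B \<in> \<S> \<Longrightarrow> A \<inter> B \<in> \<S>"
    and Diff_closed: "A \<in> \<S> \<Longrightarrow> B \<in> \<S> \<Longrightarrow> A - B \<in> \<S>"
    and insert_closed: "A \<in> \<S> \<Longrightarrow> insert x A \<in> \<S>"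
    and segment_closed: "A \<in> \<S> \<Longrightarrow> {y \<in> A. y \<sqsubset> x} \<in> \<S>"
    and h_in: "\<lbrakk>C \<in> \<S>; C \<subseteq> P; \<And>x y. x \<in> C \<Longrightarrow> y \<in> C \<Longrightarrow> x = y \<or> x \<sqsubset> y \<or> y \<sqsubset> x\<rbrakk> \<Longrightarrow> h C \<in> P"
    and h_bound: "\<lbrakk>C \<in> \<S>; C \<subseteq> P; \<And>x y. x \<in> C \<Longrightarrow> y \<in> C \<Longrightarrow> x = y \<or> x \<sqsubset> y \<or> y \<sqsubset> x; c \<in> C\<rbrakk>
       \<Longrightarrow> c \<sqsubset> h C"
begin

definition segment :: "'a set \<Rightarrow> 'a \<Rightarrow> 'a set" where
  "segment C x = {y \<in> C. y \<sqsubset> x}"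

text \<open>These are the chains grown by iterating \<open>h\<close>: well-ordered, each element
  being the value of \<open>h\<close> on its predecessors. Least elements are demanded only for
  subsets in \<open>\<S>\<close>, so that well-ordering means what the structure can
  express.\<close>

definition conforming :: "'a set \<Rightarrow> bool" where
  "conforming C \<longleftrightarrow> C \<in> \<S> \<and> C \<subseteq> P \<and>
     (\<forall>x\<in>C. \<forall>y\<in>C. x = y \<or> x \<sqsubset> y \<or> y \<sqsubset> x) \<and>
     (\<forall>S\<in>\<S>. S \<subseteq> C \<and> S \<noteq> {} \<longrightarrow> (\<exists>m\<in>S. \<forall>y\<in>S. y = m \<or> m \<sqsubset> y)) \<and>
     (\<forall>x\<in>C. x = h (segment C x))"

lemma conforming_least:
  assumes "conforming C" "S \<in> \<S>" "S \<subseteq> C" "S \<noteq> {}"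
  obtains m where "m \<in> S" "\<And>y. y \<in> S \<Longrightarrow> y = m \<or> m \<sqsubset> y"
proof -
  have "\<forall>S\<in>\<S>. S \<subseteq> C \<and> S \<noteq> {} \<longrightarrow> (\<exists>m\<in>S. \<forall>y\<in>S. y = m \<or> m \<sqsubset> y)"
    by (rule conforming_def[THEN iffD1, OF assms(1), THEN conjunct2, THEN conjunct2, THEN conjunct2,
          THEN conjunct1])
  then have "\<exists>m\<in>S. \<forall>y\<in>S. y = m \<or> m \<sqsubset> y" using assms(2-4) by simp
  then show thesis using that by blast
qed

lemma conforming_total:
  assumes "conforming C" "x \<in> C" "y \<in> C"
  shows "x = y \<or> x \<sqsubset> y \<or> y \<sqsubset> x"
  using conforming_def[THEN iffD1, OF assms(1), THEN conjunct2, THEN conjunct2, THEN conjunct1]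
    assms(2,3) by blast

lemma conforming_in: "conforming C \<Longrightarrow> C \<in> \<S>"
  by (erule conforming_def[THEN iffD1, THEN conjunct1])

lemma conforming_subset: "conforming C \<Longrightarrow> C \<subseteq> P"
  by (erule conforming_def[THEN iffD1, THEN conjunct2, THEN conjunct1])

lemma conforming_h:
  assumes "conforming C" "x \<in> C"
  shows "x = h (segment C x)"
  using conforming_def[THEN iffD1, OF assms(1), THEN conjunct2, THEN conjunct2, THEN conjunct2,
      THEN conjunct2] assms(2) by blast

text \<open>Both chains compute their elements by \<open>h\<close> from the preceding ones, so at a
  first point of disagreement equal initial segments would force equal next elements.\<close>

lemma conforming_initial:
  assumes A: "conforming A" and B: "conforming B" and ne: "A - B \<noteq> {}"
  obtains x where "x \<in> A" "B = segment A x"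
proof -
  have AS: "A \<in> \<S>" and BS: "B \<in> \<S>"
    using A B conforming_in by blast+
  obtain x where x: "x \<in> A - B" and x_least: "\<And>y. y \<in> A - B \<Longrightarrow> y = x \<or> x \<sqsubset> y"
    using conforming_least[OF A Diff_closed[OF AS BS] _ ne] by blast
  have seg_x: "segment A x \<subseteq> B"
    unfolding segment_def using x_least irrefl trans by blast
  have "B = segment A x"
  proof (rule ccontr)
    assume "B \<noteq> segment A x"
    then have "B - segment A x \<noteq> {}" using seg_x by blast
    moreover have "B - segment A x \<in> \<S>"
      unfolding segment_def using AS BS segment_closed Diff_closed by blast
    ultimately obtain y where y: "y \<in> B - segment A x"
      and y_least: "\<And>z. z \<in> B - segment A x \<Longrightarrow> z = y \<or> y \<sqsubset> z"
      using conforming_least[OF B] by blast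
    have seg_y: "segment B y \<subseteq> segment A x"
      using y_least irrefl trans unfolding segment_def by blast
    \<comment> \<open>Below \<open>y\<close> the two chains agree, so this segment of
      \<open>B\<close> is also closed downwards in \<open>A\<close>; hence no element of it lies
      above \<open>z\<close>.\<close>
    have down: "v \<in> segment B y" if "u \<in> segment B y" "v \<in> A" "v \<sqsubset> u" for u v
    proof -
      have "v \<in> segment A x"
        using that seg_y trans unfolding segment_def by blast
      then show ?thesis using that seg_x trans unfolding segment_def by blast
    qed
    have "A - segment B y \<in> \<S>"
      unfolding segment_def using AS BS segment_closed Diff_closed by blast
    moreover have x': "x \<in> A - segment B y" using x unfolding segment_def by blast
    ultimately obtain z where z: "z \<in> A - segment B y"
      and z_least: "\<And>w. w \<in> A - segment B y \<Longrightarrow> w = z \<or> z \<sqsubset> w"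
      using conforming_least[OF A] by (metis Diff_subset empty_iff)
    have "segment A z = segment B y"
    proof
      show "segment A z \<subseteq> segment B y"
        using z_least irrefl trans unfolding segment_def by blast
      show "segment B y \<subseteq> segment A z"
      proof
        fix u assume u: "u \<in> segment B y"
        then have "u \<in> A" using seg_y unfolding segment_def by blast
        moreover have "u \<noteq> z" "\<not> z \<sqsubset> u" using u z down by blast+
        ultimately show "u \<in> segment A z"
          using conforming_total[OF A, of u z] z unfolding segment_def by blast
      qed
    qed
    then have "z = y"
      using conforming_h[OF A, of z] conforming_h[OF B, of y] y z by simp
    \<comment> \<open>Leastness gives \<open>z = x\<close> or \<open>z \<sqsubset> x\<close>. The
      former fails because \<open>z = y\<close> lies in \<open>B\<close> and \<open>x\<close> does
      not.\<close>
    then have "z \<in> segment A x"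
      using z_least[OF x'] x y z unfolding segment_def by blast
    then show False using y \<open>z = y\<close> by blast
  qed
  then show thesis using x that by blast
qed

text \<open>If the union were in \<open>\<S>\<close>, it would be a largest conforming chain; adding
  \<open>h\<close> of it would give a larger one.\<close>

lemma Union_conforming_not_in:
  "\<Union>{C. conforming C} \<notin> \<S>"
proof
  define U where "U = \<Union>{C. conforming C}"
  assume "\<Union>{C. conforming C} \<in> \<S>"
  then have US: "U \<in> \<S>" unfolding U_def .
  have UP: "U \<subseteq> P" unfolding U_def using conforming_subset by blast
  \<comment> \<open>By comparability every conforming chain is an initial segment of
    \<open>U\<close>, so leastness and \<open>h\<close>-values can be checked in a single
    chain.\<close>
  have down: "v \<in> A" if A: "conforming A" and "u \<in> A" "v \<in> U" "v \<sqsubset> u" for A u v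
  proof (rule ccontr)
    assume v: "v \<notin> A"
    obtain B where B: "conforming B" "v \<in> B" using \<open>v \<in> U\<close> unfolding U_def by blast
    then obtain w where "w \<in> B" "A = segment B w"
      using conforming_initial[OF B(1) A] v by blast
    then show False using that v B trans unfolding segment_def by blast
  qed
  have total: "x = y \<or> x \<sqsubset> y \<or> y \<sqsubset> x" if xy: "x \<in> U" "y \<in> U" for x y
  proof -
    obtain A B where A: "conforming A" "x \<in> A" and B: "conforming B" "y \<in> B"
      using xy unfolding U_def by blast
    show ?thesis
    proof (cases "y \<in> A")
      case True
      then show ?thesis using conforming_total A by blast
    next
      case False
      then have "A \<subseteq> B"
        using conforming_initial[OF B(1) A(1)] B unfolding segment_def by blast
      then show ?thesis using conforming_total A B by blast
    qed
  qed
  have least: "\<exists>m\<in>S. \<forall>y\<in>S. y = m \<or> m \<sqsubset> y" if S: "S \<in> \<S>" "S \<subseteq> U" "S \<noteq> {}" for S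
  proof -
    obtain s A where s: "s \<in> S" "s \<in> A" and A: "conforming A"
      using S unfolding U_def by blast
    have "S \<inter> A \<in> \<S>" using Int_closed S conforming_in[OF A] by blast
    then obtain m where m: "m \<in> S \<inter> A" "\<And>y. y \<in> S \<inter> A \<Longrightarrow> y = m \<or> m \<sqsubset> y"
      using conforming_least[OF A] s by (metis Int_lower2 IntI empty_iff)
    have "y = m \<or> m \<sqsubset> y" if y: "y \<in> S" for y
      using m total[of y m] down[OF A, of m y] y S(2) by blast
    then show ?thesis using m by blast
  qed
  have hU: "h U \<in> P" and bound: "\<And>c. c \<in> U \<Longrightarrow> c \<sqsubset> h U"
    using h_in[OF US UP] h_bound[OF US UP] total by blast+
  have h_notin: "h U \<notin> U" using bound irrefl by blast
  have seg_U: "x = h (segment U x)" if "x \<in> U" for x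
  proof -
    obtain A where A: "conforming A" "x \<in> A" using \<open>x \<in> U\<close> unfolding U_def by blast
    have "segment U x = segment A x"
      using down[OF A] A(1) unfolding segment_def U_def by blast
    then show ?thesis using conforming_h[OF A] by simp
  qed
  define C where "C = insert (h U) U"
  have "conforming C"
    unfolding conforming_def
  proof (intro conjI ballI impI)
    show "C \<in> \<S>" unfolding C_def using US insert_closed by blast
    show "C \<subseteq> P" unfolding C_def using UP hU by blast
  next
    fix x y assume "x \<in> C" "y \<in> C"
    then show "x = y \<or> x \<sqsubset> y \<or> y \<sqsubset> x" unfolding C_def using total bound by blast
  next
    fix S assume S: "S \<in> \<S>" "S \<subseteq> C \<and> S \<noteq> {}"
    show "\<exists>m\<in>S. \<forall>y\<in>S. y = m \<or> m \<sqsubset> y"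
    proof (cases "S \<inter> U = {}")
      case True
      then show ?thesis using S unfolding C_def by blast
    next
      case False
      then obtain m where "m \<in> S \<inter> U" "\<forall>y\<in>S \<inter> U. y = m \<or> m \<sqsubset> y"
        using least[of "S \<inter> U"] Int_closed S US by blast
      then show ?thesis using S bound unfolding C_def by blast
    qed
  next
    fix x assume x: "x \<in> C"
    show "x = h (segment C x)"
    proof (cases "x \<in> U")
      case True
      then have "segment C x = segment U x"
        unfolding C_def segment_def using bound irrefl trans by blast
      then show ?thesis using seg_U[OF True] by simp
    next
      case False
      then have "x = h U" using x unfolding C_def by blast
      then have "segment C x = U"
        unfolding C_def segment_def using bound irrefl by blast
      then show ?thesis using \<open>x = h U\<close> by simp
    qed
  qed
  then have "h U \<in> U" unfolding U_def C_def by blast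
  then show False using h_notin by blast
qed

end


section \<open>Definability\<close>

context membership_structure
begin

section \<open>Finite support and renaming of variables\<close>

lemma sat_finite_support:
  "\<exists>N. \<forall>s s'. (\<forall>i<N. s i = s' i) \<longrightarrow> sat \<phi> s = sat \<phi> s'"
proof (induction \<phi>)
  case (Member i j)
  show ?case by (rule exI[of _ "Suc (max i j)"]) (auto simp: less_Suc_eq_le)
next
  case (Equal i j)
  show ?case by (rule exI[of _ "Suc (max i j)"]) (auto simp: less_Suc_eq_le)
next
  case (Neg \<phi>)
  then show ?case by auto
next
  case (Conj \<phi> \<psi>)
  then obtain N M where
    N: "\<And>s s'. (\<forall>i<N. s i = s' i) \<Longrightarrow> sat \<phi> s = sat \<phi> s'" and
    M: "\<And>s s'. (\<forall>i<M. s i = s' i) \<Longrightarrow> sat \<psi> s = sat \<psi> s'"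
    by blast
  show ?case
  proof (intro exI[of _ "max N M"] allI impI)
    fix s s' :: "nat \<Rightarrow> 'v" assume "\<forall>i<max N M. s i = s' i"
    then show "sat (Conj \<phi> \<psi>) s = sat (Conj \<phi> \<psi>) s'"
      using N[of s s'] M[of s s'] by simp
  qed
next
  case (Forall k \<phi>)
  then obtain N where N: "\<And>s s'. (\<forall>i<N. s i = s' i) \<Longrightarrow> sat \<phi> s = sat \<phi> s'" by blast
  show ?case
  proof (intro exI[of _ N] allI impI)
    fix s s' :: "nat \<Rightarrow> 'v" assume "\<forall>i<N. s i = s' i"
    then show "sat (Forall k \<phi>) s = sat (Forall k \<phi>) s'"
      using N[of "s(k := a)" "s'(k := a)" for a] by simp
  qed
qed

text \<open>The map need not be injective. Finite support leaves a variable outside the image of all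
  relevant ones; renaming the bound variable to it avoids capture.\<close>

lemma sat_rename:
  "\<exists>\<psi>. \<forall>s. sat \<psi> s = sat \<phi> (\<lambda>i. s (\<rho> i))"
proof (induction \<phi> arbitrary: \<rho>)
  case (Member i j)
  show ?case by (rule exI[of _ "Member (\<rho> i) (\<rho> j)"]) simp
next
  case (Equal i j)
  show ?case by (rule exI[of _ "Equal (\<rho> i) (\<rho> j)"]) simp
next
  case (Neg \<phi>)
  then obtain \<psi> where "\<forall>s. sat \<psi> s = sat \<phi> (\<lambda>i. s (\<rho> i))" by blast
  then show ?case by (intro exI[of _ "Neg \<psi>"]) simp
next
  case (Conj \<phi>1 \<phi>2)
  then obtain \<psi>1 \<psi>2 where "\<forall>s. sat \<psi>1 s = sat \<phi>1 (\<lambda>i. s (\<rho> i))"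
    "\<forall>s. sat \<psi>2 s = sat \<phi>2 (\<lambda>i. s (\<rho> i))" by blast
  then show ?case by (intro exI[of _ "Conj \<psi>1 \<psi>2"]) simp
next
  case (Forall k \<phi>)
  obtain N where N: "\<And>s s'. (\<forall>i<N. s i = s' i) \<Longrightarrow> sat \<phi> s = sat \<phi> s'"
    using sat_finite_support by blast
  obtain j where j: "j \<notin> \<rho> ` {..<N}"
    using infinite_UNIV_nat ex_new_if_finite by blast
  obtain \<psi> where \<psi>: "\<And>s. sat \<psi> s = sat \<phi> (\<lambda>i. s ((\<rho>(k := j)) i))" using Forall by blast
  have "sat \<phi> (\<lambda>i. (s(j := a)) ((\<rho>(k := j)) i)) = sat \<phi> ((\<lambda>i. s (\<rho> i))(k := a))" for s a
    using j by (intro N) auto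
  then show ?case by (intro exI[of _ "Forall j \<psi>"]) (simp add: \<psi>)
qed

text \<open>
  \<open>e\<close> tells for each free variable of the formula whether it is a parameter or an argument.
\<close>

definition valuation :: "(nat \<Rightarrow> 'v + nat) \<Rightarrow> (nat \<Rightarrow> 'v) \<Rightarrow> nat \<Rightarrow> 'v" where
  "valuation e s i = (case e i of Inl v \<Rightarrow> v | Inr k \<Rightarrow> s k)"

definition definable :: "((nat \<Rightarrow> 'v) \<Rightarrow> bool) \<Rightarrow> bool" where
  "definable Q \<longleftrightarrow> (\<exists>\<phi> e. \<forall>s. Q s \<longleftrightarrow> sat \<phi> (valuation e s))"

text \<open>The language has no function symbols, so a term is either a parameter or an
  argument.\<close>

definition definable_term :: "((nat \<Rightarrow> 'v) \<Rightarrow> 'v) \<Rightarrow> bool" where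
  "definable_term t \<longleftrightarrow> (\<exists>c. \<forall>s. t s = (case c of Inl v \<Rightarrow> v | Inr k \<Rightarrow> s k))"

section \<open>Closure of definability under the logical operations\<close>

lemma definable_term_arg: "definable_term (\<lambda>s. s k)"
  unfolding definable_term_def by (rule exI[of _ "Inr k"]) simp

lemma definable_term_param: "definable_term (\<lambda>s. v)"
  unfolding definable_term_def by (rule exI[of _ "Inl v"]) simp

lemma definable_mem:
  assumes "definable_term t" "definable_term u"
  shows "definable (\<lambda>s. t s \<^bold>\<in> u s)"
proof -
  obtain c d where "\<forall>s. t s = (case c of Inl v \<Rightarrow> v | Inr k \<Rightarrow> s k)"
    "\<forall>s. u s = (case d of Inl v \<Rightarrow> v | Inr k \<Rightarrow> s k)"
    using assms unfolding definable_term_def by blast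
  then show ?thesis unfolding definable_def
    by (intro exI[of _ "Member 0 1"] exI[of _ "\<lambda>i. if i = 0 then c else d"])
      (simp add: valuation_def)
qed

lemma definable_eq:
  assumes "definable_term t" "definable_term u"
  shows "definable (\<lambda>s. t s = u s)"
proof -
  obtain c d where "\<forall>s. t s = (case c of Inl v \<Rightarrow> v | Inr k \<Rightarrow> s k)"
    "\<forall>s. u s = (case d of Inl v \<Rightarrow> v | Inr k \<Rightarrow> s k)"
    using assms unfolding definable_term_def by blast
  then show ?thesis unfolding definable_def
    by (intro exI[of _ "Equal 0 1"] exI[of _ "\<lambda>i. if i = 0 then c else d"])
      (simp add: valuation_def)
qed

lemma definable_not:
  assumes "definable Q"
  shows "definable (\<lambda>s. \<not> Q s)"
proof -
  obtain \<phi> e where "\<forall>s. Q s \<longleftrightarrow> sat \<phi> (valuation e s)"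
    using assms unfolding definable_def by blast
  then show ?thesis unfolding definable_def
    by (intro exI[of _ "Neg \<phi>"] exI[of _ e]) simp
qed

lemma definable_conj:
  assumes "definable Q" "definable Q'"
  shows "definable (\<lambda>s. Q s \<and> Q' s)"
proof -
  obtain \<phi> e \<phi>' e' where
    \<phi>: "\<And>s. Q s \<longleftrightarrow> sat \<phi> (valuation e s)" and \<phi>': "\<And>s. Q' s \<longleftrightarrow> sat \<phi>' (valuation e' s)"
    using assms unfolding definable_def by metis
  \<comment> \<open>The two formulas may give the same variable different meanings, so their free
    variables are separated into even and odd ones.\<close>
  obtain \<psi> \<psi>' where \<psi>: "\<And>s. sat \<psi> s = sat \<phi> (\<lambda>i. s (2 * i))"
    and \<psi>': "\<And>s. sat \<psi>' s = sat \<phi>' (\<lambda>i. s (Suc (2 * i)))"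
    using sat_rename[of \<phi> "\<lambda>i. 2 * i"] sat_rename[of \<phi>' "\<lambda>i. Suc (2 * i)"] by blast
  define d where "d i = (if even i then e (i div 2) else e' (i div 2))" for i :: nat
  have "(\<lambda>i. valuation d s (2 * i)) = valuation e s"
    "(\<lambda>i. valuation d s (Suc (2 * i))) = valuation e' s" for s
    by (auto simp: valuation_def d_def fun_eq_iff)
  then show ?thesis unfolding definable_def
    by (intro exI[of _ "Conj \<psi> \<psi>'"] exI[of _ d]) (simp add: \<phi> \<phi>' \<psi> \<psi>')
qed

text \<open>
  The bound variable becomes argument \<open>0\<close> and the other arguments move up by one, so that
  resolution with this rule again yields a predicate of the arguments.
\<close>

lemma definable_all:
  assumes "definable (\<lambda>s. Q (\<lambda>n. s (Suc n)) (s 0))"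
  shows "definable (\<lambda>s. \<forall>a. Q s a)"
proof -
  obtain \<phi> e where \<phi>: "\<And>s. Q (\<lambda>n. s (Suc n)) (s 0) \<longleftrightarrow> sat \<phi> (valuation e s)"
    using assms unfolding definable_def by blast
  \<comment> \<open>Several variables may denote argument \<open>0\<close>; all are merged into
    variable \<open>0\<close>, ready to be quantified, and the others move up to make room.\<close>
  obtain \<psi> where \<psi>: "\<And>s. sat \<psi> s = sat \<phi> (\<lambda>i. s (if e i = Inr 0 then 0 else Suc i))"
    using sat_rename[of \<phi> "\<lambda>i. if e i = Inr 0 then 0 else Suc i"] by blast
  \<comment> \<open>Arguments shift back down by one. The case \<open>k = 0\<close> is never read,
    since such variables were merged into the quantified one.\<close>
  define d where "d i = (case e (i - 1) of Inl v \<Rightarrow> Inl v | Inr k \<Rightarrow> Inr (k - 1))" for i :: nat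
  have "(\<lambda>i. ((valuation d s)(0 := a)) (if e i = Inr 0 then 0 else Suc i))
      = valuation e (case_nat a s)" for s a
    by (auto simp: valuation_def d_def fun_eq_iff split: sum.split nat.split)
  then have "sat (Forall 0 \<psi>) (valuation d s) \<longleftrightarrow> (\<forall>a. Q s a)" for s
    using \<phi>[of "case_nat a s" for a] by (simp add: \<psi>)
  then show ?thesis unfolding definable_def by blast
qed

lemma definable_ex:
  assumes "definable (\<lambda>s. Q (\<lambda>n. s (Suc n)) (s 0))"
  shows "definable (\<lambda>s. \<exists>a. Q s a)"
  using definable_not[OF definable_all[of "\<lambda>s a. \<not> Q s a", OF definable_not[OF assms]]] by simp

lemma definable_disj: "definable Q \<Longrightarrow> definable Q' \<Longrightarrow> definable (\<lambda>s. Q s \<or> Q' s)"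
  using definable_not[OF definable_conj[OF definable_not definable_not]] by simp

lemma definable_imp: "definable Q \<Longrightarrow> definable Q' \<Longrightarrow> definable (\<lambda>s. Q s \<longrightarrow> Q' s)"
  unfolding imp_conv_disj by (intro definable_disj definable_not)

lemma definable_iff: "definable Q \<Longrightarrow> definable Q' \<Longrightarrow> definable (\<lambda>s. Q s \<longleftrightarrow> Q' s)"
  using definable_conj[OF definable_imp definable_imp, of Q Q' Q' Q]
  by (simp only: iff_conv_conj_imp)

lemmas definable_intros =
  definable_term_arg definable_term_param definable_mem definable_eq definable_not
  definable_conj definable_disj definable_imp definable_iff definable_all definable_ex

lemmas language_defs =
  related_def is_pair_def is_upair_def is_empty_def subset_def Ex1_def

end


section \<open>Sets and relations in a model of ZF\<close>

locale ZF_structure = membership_structure mem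
  for mem :: "'v \<Rightarrow> 'v \<Rightarrow> bool"  (infix "\<^bold>\<in>" 50) +
  assumes ZF
begin

lemma ext: "(\<And>x. x \<^bold>\<in> a \<longleftrightarrow> x \<^bold>\<in> b) \<Longrightarrow> a = b"
  using ZF_structure_axioms unfolding ZF_structure_def ZF_def extensionality_def by blast

text \<open>This passes from the schema over formulas to predicates whose definability is derived
  from their shape by \<open>definable_intros\<close>.\<close>

lemma separation_definable:
  assumes "definable (\<lambda>s. Q (s 0))"
  shows "\<exists>b. \<forall>x. x \<^bold>\<in> b \<longleftrightarrow> x \<^bold>\<in> a \<and> Q x"
proof -
  obtain \<phi> e where \<phi>: "\<And>s. Q (s 0) \<longleftrightarrow> sat \<phi> (valuation e s)"
    using assms unfolding definable_def by blast
  \<comment> \<open>All arguments collapse to variable \<open>0\<close>, which is harmless because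
    the predicate depends on \<open>s 0\<close> only. Parameters move up, and \<open>p\<close>
    supplies them, with \<open>a\<close> as a dummy elsewhere.\<close>
  obtain \<psi> where \<psi>: "\<And>s. sat \<psi> s = sat \<phi> (\<lambda>i. s (case e i of Inl v \<Rightarrow> Suc i | Inr k \<Rightarrow> 0))"
    using sat_rename[of \<phi> "\<lambda>i. case e i of Inl v \<Rightarrow> Suc i | Inr k \<Rightarrow> 0"] by blast
  define p where "p i = (case e (i - 1) of Inl v \<Rightarrow> v | Inr k \<Rightarrow> a)" for i :: nat
  have "(\<lambda>i. (p(0 := x)) (case e i of Inl v \<Rightarrow> Suc i | Inr k \<Rightarrow> 0)) = valuation e (\<lambda>_. x)" for x
    by (auto simp: p_def valuation_def fun_eq_iff split: sum.split)
  then have "sat \<psi> (p(0 := x)) \<longleftrightarrow> Q x" for x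
    using \<phi>[of "\<lambda>_. x"] by (simp add: \<psi>)
  moreover have "separation"
    using ZF_structure_axioms unfolding ZF_structure_def ZF_def by blast
  ultimately show ?thesis
    unfolding separation_def by metis
qed

section \<open>Pairs, unions and relations as sets\<close>

lemma upair_ex: "\<exists>u. is_upair u a b"
  using ZF_structure_axioms unfolding ZF_structure_def ZF_def pairing_def by blast

lemma pair_ex: "\<exists>u. is_pair u a b"
  unfolding is_pair_def using upair_ex by meson

lemma upair_unique: "is_upair u a b \<Longrightarrow> is_upair v a b \<Longrightarrow> u = v"
  unfolding is_upair_def by (rule ext) simp

lemma pair_unique: "is_pair u a b \<Longrightarrow> is_pair v a b \<Longrightarrow> u = v"
  unfolding is_pair_def using upair_unique by metis

lemma pair_inject:
  assumes "is_pair u a b" "is_pair u c d"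
  shows "a = c \<and> b = d"
proof -
  obtain v w v' w' where v: "is_upair v a a" "is_upair w a b" "is_upair u v w"
    and v': "is_upair v' c c" "is_upair w' c d" "is_upair u v' w'"
    using assms unfolding is_pair_def by blast
  have uu: "{v, w} = {v', w'}" using v(3) v'(3) unfolding is_upair_def by blast
  have "a = c" using uu v(1,2) v'(1,2) unfolding is_upair_def by (metis doubleton_eq_iff)
  moreover have "b = d"
    using uu v(1,2) v'(1,2) unfolding is_upair_def by (metis doubleton_eq_iff)
  ultimately show ?thesis ..
qed

lemma related_iff_mem: "is_pair u x y \<Longrightarrow> related r x y \<longleftrightarrow> u \<^bold>\<in> r"
  unfolding related_def using pair_unique by blast

lemma Union_ex: "\<exists>b. \<forall>x. x \<^bold>\<in> b \<longleftrightarrow> (\<exists>y. y \<^bold>\<in> a \<and> x \<^bold>\<in> y)"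
  using ZF_structure_axioms unfolding ZF_structure_def ZF_def union_def by blast

lemma Pow_ex: "\<exists>b. \<forall>x. x \<^bold>\<in> b \<longleftrightarrow> subset x a"
  using ZF_structure_axioms unfolding ZF_structure_def ZF_def power_set_def by blast

lemma Un_ex: "\<exists>c. \<forall>x. x \<^bold>\<in> c \<longleftrightarrow> x \<^bold>\<in> a \<or> x \<^bold>\<in> b"
proof -
  obtain u where u: "is_upair u a b" using upair_ex by blast
  obtain c where "\<And>x. x \<^bold>\<in> c \<longleftrightarrow> (\<exists>y. y \<^bold>\<in> u \<and> x \<^bold>\<in> y)" using Union_ex by blast
  then have "x \<^bold>\<in> c \<longleftrightarrow> x \<^bold>\<in> a \<or> x \<^bold>\<in> b" for x using u unfolding is_upair_def by auto
  then show ?thesis by blast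
qed

text \<open>Kuratowski pairs over \<open>a\<close> and \<open>b\<close> lie in the double power set
  of their union, from which Separation cuts out the relation. The indices in the hypothesis are
  those left after stripping the quantifiers over \<open>x\<close> and then
  \<open>y\<close>.\<close>

lemma relation_ex:
  assumes Q: "definable (\<lambda>s. Q (s 1) (s 0))"
  obtains r where "\<And>u. u \<^bold>\<in> r \<Longrightarrow> \<exists>x y. x \<^bold>\<in> a \<and> y \<^bold>\<in> b \<and> is_pair u x y"
    and "\<And>x y. related r x y \<longleftrightarrow> x \<^bold>\<in> a \<and> y \<^bold>\<in> b \<and> Q x y"
proof -
  obtain c where c: "\<And>x. x \<^bold>\<in> c \<longleftrightarrow> x \<^bold>\<in> a \<or> x \<^bold>\<in> b" using Un_ex by blast
  obtain d where d: "\<And>x. x \<^bold>\<in> d \<longleftrightarrow> subset x c" using Pow_ex by blast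
  obtain e where e: "\<And>x. x \<^bold>\<in> e \<longleftrightarrow> subset x d" using Pow_ex by blast
  obtain r where r: "\<And>u. u \<^bold>\<in> r \<longleftrightarrow> u \<^bold>\<in> e \<and> (\<exists>x y. (x \<^bold>\<in> a \<and> y \<^bold>\<in> b \<and> is_pair u x y) \<and> Q x y)"
  proof -
    have "definable (\<lambda>s. Q (s (Suc 0)) (s 0))" using Q by simp
    then have "definable (\<lambda>s. \<exists>x y. (x \<^bold>\<in> a \<and> y \<^bold>\<in> b \<and> is_pair (s 0) x y) \<and> Q x y)"
      unfolding language_defs by (intro definable_intros)
    from separation_definable[OF this, of e] show thesis using that by blast
  qed
  have "u \<^bold>\<in> e" if "x \<^bold>\<in> a" "y \<^bold>\<in> b" "is_pair u x y" for u x y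
    using that unfolding e d c subset_def is_pair_def is_upair_def by metis
  then have "related r x y \<longleftrightarrow> x \<^bold>\<in> a \<and> y \<^bold>\<in> b \<and> Q x y" for x y
    unfolding related_def r using pair_inject pair_ex by metis
  moreover have "\<exists>x y. x \<^bold>\<in> a \<and> y \<^bold>\<in> b \<and> is_pair u x y" if "u \<^bold>\<in> r" for u
    using that unfolding r by blast
  ultimately show thesis by (rule that[rotated])
qed


section \<open>Choice implies generic filters\<close>

text \<open>The bridge to the abstract chain argument: \<open>range extent\<close> consists of the
  collections that are sets in the structure and plays the role of \<open>\<S>\<close>.\<close>

definition extent :: "'v \<Rightarrow> 'v set" where
  "extent a = {x. x \<^bold>\<in> a}"

lemma mem_extent [simp]: "x \<in> extent a \<longleftrightarrow> x \<^bold>\<in> a"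
  unfolding extent_def by simp

lemma extent_separation:
  assumes "definable (\<lambda>s. Q (s 0))"
  shows "{x \<in> extent a. Q x} \<in> range extent"
proof -
  from separation_definable[OF assms]
  obtain b where "\<forall>x. x \<^bold>\<in> b \<longleftrightarrow> x \<^bold>\<in> a \<and> Q x" ..
  then have "{x \<in> extent a. Q x} = extent b" by (intro set_eqI) simp
  then show ?thesis by (rule image_eqI) (rule UNIV_I)
qed

lemma extent_insert: "insert x (extent a) \<in> range extent"
proof -
  obtain u where u: "is_upair u x x" using upair_ex by blast
  obtain c where "\<And>y. y \<^bold>\<in> c \<longleftrightarrow> y \<^bold>\<in> a \<or> y \<^bold>\<in> u" using Un_ex by blast
  then have "insert x (extent a) = extent c" using u unfolding is_upair_def by auto
  then show ?thesis by blast
qed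

text \<open>Without minimal elements every chain has a strict lower bound, and a choice function
  selects one. This selection is definable, so the union of the conforming chains is a set, which
  \<open>Union_conforming_not_in\<close> forbids.\<close>

lemma Zorn_minimal:
  assumes AC and po: "partial_order P R" and zorn: "Zorn_order P R"
  obtains p where "minimal P R p"
proof (rule ccontr)
  assume "\<not> thesis"
  then have no_minimal: "\<not> minimal P R p" for p using that by blast
  \<comment> \<open>The order is reversed: \<open>below y x\<close> puts \<open>x\<close> strictly
    under \<open>y\<close> in \<open>R\<close>, so upper bounds for \<open>below\<close> are lower
    bounds for \<open>R\<close>.\<close>
  define below where "below y x \<longleftrightarrow> related R x y \<and> x \<noteq> y" for x y
  have below_trans: "below x y \<Longrightarrow> below y z \<Longrightarrow> below x z" for x y z
    unfolding below_def using po unfolding partial_order_def by metis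
  obtain pw where pw: "\<And>x. x \<^bold>\<in> pw \<longleftrightarrow> subset x P" using Pow_ex by blast
  have "definable (\<lambda>s. \<not> is_empty (s 0))"
    unfolding language_defs by (intro definable_intros)
  from separation_definable[OF this, of pw]
  obtain F where F: "\<And>X. X \<^bold>\<in> F \<longleftrightarrow> X \<^bold>\<in> pw \<and> \<not> is_empty X" by blast
  obtain f where f: "choice_function f F" using \<open>AC\<close> F unfolding AC_def by blast
  define bounds where "bounds L C \<longleftrightarrow> (\<forall>b. b \<^bold>\<in> L \<longleftrightarrow> b \<^bold>\<in> P \<and> (\<forall>c\<in>C. below c b))" for L C
  \<comment> \<open>The graph of \<open>h\<close> is kept apart because, unlike the description
    operator, it translates into a first-order formula.\<close>
  define chosen where "chosen C x \<longleftrightarrow> (\<exists>L. bounds L C \<and> related f L x)" for C x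
  define h where "h C = (THE x. chosen C x)" for C
  have chosen: "chosen C (h C) \<and> h C \<^bold>\<in> P \<and> (\<forall>c\<in>C. below c (h C)) \<and> (\<forall>x. chosen C x \<longrightarrow> x = h C)"
    if C: "C \<in> range extent" "C \<subseteq> extent P"
      and lin: "\<And>x y. x \<in> C \<Longrightarrow> y \<in> C \<Longrightarrow> x = y \<or> below x y \<or> below y x" for C
  proof -
    obtain c where c: "C = extent c" using C by blast
    have "subset c P" using C c unfolding subset_def by auto
    moreover have "linearly_ordered R c"
      unfolding linearly_ordered_def
      using lin c po C(2) unfolding below_def partial_order_def by (metis mem_extent subsetD)
    ultimately obtain b where b: "b \<^bold>\<in> P" "\<And>x. x \<^bold>\<in> c \<Longrightarrow> related R b x"
      using zorn unfolding Zorn_order_def by blast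
    obtain b' where b': "b' \<^bold>\<in> P" "below b b'"
      using no_minimal[of b] b(1) unfolding minimal_def below_def by blast
    have strict: "below x b'" if "x \<^bold>\<in> c" for x
      using b(2)[OF that] b'(2) below_trans unfolding below_def by metis
    have "definable (\<lambda>s. \<forall>x. x \<^bold>\<in> c \<longrightarrow> below x (s 0))"
      unfolding below_def language_defs by (intro definable_intros)
    from separation_definable[OF this, of P]
    obtain L where L: "\<And>b. b \<^bold>\<in> L \<longleftrightarrow> b \<^bold>\<in> P \<and> (\<forall>x. x \<^bold>\<in> c \<longrightarrow> below x b)" by blast
    then have bounds: "bounds L' C \<longleftrightarrow> L' = L" for L'
      unfolding bounds_def c by (auto intro: ext)
    have LF: "L \<^bold>\<in> F"
      unfolding F pw subset_def is_empty_def using L b' strict by blast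
    then obtain x where x: "related f L x" "\<And>y. related f L y \<Longrightarrow> y = x"
      using f unfolding choice_function_def function_on_def by blast
    have "x \<^bold>\<in> L" using f LF x unfolding choice_function_def by blast
    have iff: "chosen C y \<longleftrightarrow> y = x" for y
      unfolding chosen_def bounds using x by blast
    have "h C = x" unfolding h_def by (rule the_equality) (simp_all add: iff)
    then show ?thesis using L c iff \<open>x \<^bold>\<in> L\<close> by simp
  qed
  have segment_small: "{y \<in> C. below y x} \<in> range extent" if "C \<in> range extent" for C x
  proof -
    obtain c where c: "C = extent c" using \<open>C \<in> range extent\<close> by blast
    have "definable (\<lambda>s. below (s 0) x)"
      unfolding below_def language_defs by (intro definable_intros)
    then show ?thesis unfolding c by (rule extent_separation)
  qed
  interpret bounded_chain_choice "extent P" below "range extent" h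
  proof
    fix x show "\<not> below x x" unfolding below_def by blast
  next
    fix x y z assume "below x y" "below y z"
    then show "below x z" by (rule below_trans)
  next
    fix A B assume "A \<in> range extent" "B \<in> range extent"
    then obtain a b where ab: "A = extent a" "B = extent b" by blast
    have "definable (\<lambda>s. s 0 \<^bold>\<in> b)" by (intro definable_intros)
    from extent_separation[OF this, of a] show "A \<inter> B \<in> range extent"
      unfolding ab by (simp add: Int_def)
    have "definable (\<lambda>s. \<not> s 0 \<^bold>\<in> b)" by (intro definable_intros)
    from extent_separation[OF this, of a] show "A - B \<in> range extent"
      unfolding ab by (simp add: set_diff_eq)
  next
    fix A x assume "A \<in> range extent"
    then show "insert x A \<in> range extent" using extent_insert by blast
  qed (use segment_small chosen in auto)
  \<comment> \<open>A first-order rendering of \<open>conforming\<close>: subsets are quantified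
    inside the structure, and the value of \<open>h\<close> is expressed through the set
    \<open>L\<close> of strict bounds and \<open>f\<close>.\<close>
  define conf where "conf c \<longleftrightarrow> subset c P \<and>
     (\<forall>x. x \<^bold>\<in> c \<longrightarrow> (\<forall>y. y \<^bold>\<in> c \<longrightarrow> x = y \<or> below x y \<or> below y x)) \<and>
     (\<forall>s. subset s c \<and> \<not> is_empty s \<longrightarrow>
        (\<exists>m. m \<^bold>\<in> s \<and> (\<forall>y. y \<^bold>\<in> s \<longrightarrow> y = m \<or> below m y))) \<and>
     (\<forall>x. x \<^bold>\<in> c \<longrightarrow> (\<exists>L. (\<forall>b. b \<^bold>\<in> L \<longleftrightarrow> b \<^bold>\<in> P \<and> (\<forall>y. y \<^bold>\<in> c \<and> below y x \<longrightarrow> below y b))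
        \<and> related f L x))" for c
  have conf: "conforming (extent c) \<longleftrightarrow> conf c" for c
  proof -
    have 1: "extent c \<subseteq> extent P \<longleftrightarrow> subset c P" unfolding subset_def by auto
    have 2: "(\<forall>S\<in>range extent. S \<subseteq> extent c \<and> S \<noteq> {} \<longrightarrow> (\<exists>m\<in>S. \<forall>y\<in>S. y = m \<or> below m y))
      \<longleftrightarrow> (\<forall>s. subset s c \<and> \<not> is_empty s \<longrightarrow>
        (\<exists>m. m \<^bold>\<in> s \<and> (\<forall>y. y \<^bold>\<in> s \<longrightarrow> y = m \<or> below m y)))"
      unfolding subset_def is_empty_def extent_def by auto
    \<comment> \<open>Only on chains in \<open>P\<close> is \<open>h\<close> known to agree with
      \<open>chosen\<close>, so the earlier conjuncts of \<open>conf\<close> serve as hypotheses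
      here.\<close>
    have 3: "x = h (segment (extent c) x) \<longleftrightarrow>
        (\<exists>L. (\<forall>b. b \<^bold>\<in> L \<longleftrightarrow> b \<^bold>\<in> P \<and> (\<forall>y. y \<^bold>\<in> c \<and> below y x \<longrightarrow> below y b)) \<and> related f L x)"
      if "subset c P" "\<forall>x. x \<^bold>\<in> c \<longrightarrow> (\<forall>y. y \<^bold>\<in> c \<longrightarrow> x = y \<or> below x y \<or> below y x)" for x
    proof -
      have "segment (extent c) x \<in> range extent"
        unfolding segment_def by (rule segment_small) simp
      moreover have "segment (extent c) x \<subseteq> extent P"
        using that(1) unfolding segment_def subset_def by auto
      moreover have "y = z \<or> below y z \<or> below z y"
        if "y \<in> segment (extent c) x" "z \<in> segment (extent c) x" for y z
        using that \<open>\<forall>x. x \<^bold>\<in> c \<longrightarrow> (\<forall>y. y \<^bold>\<in> c \<longrightarrow> x = y \<or> below x y \<or> below y x)\<close>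
        unfolding segment_def by simp
      ultimately have "x = h (segment (extent c) x) \<longleftrightarrow> chosen (segment (extent c) x) x"
        using chosen[of "segment (extent c) x"] by metis
      then show ?thesis unfolding chosen_def bounds_def segment_def by auto
    qed
    have 4: "extent c \<in> range extent" by simp
    show ?thesis
      unfolding conforming_def 2
      unfolding conf_def 1 Ball_def mem_extent using 3 4 by (simp cong: conj_cong)
  qed
  have "definable (\<lambda>s. \<exists>c. conf c \<and> s 0 \<^bold>\<in> c)"
    unfolding conf_def below_def language_defs by (intro definable_intros)
  then have "{x \<in> extent P. \<exists>c. conf c \<and> x \<^bold>\<in> c} \<in> range extent"
    by (rule extent_separation)
  moreover have "{x \<in> extent P. \<exists>c. conf c \<and> x \<^bold>\<in> c} = \<Union>{C. conforming C}"
  proof -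
    have "\<Union>{C. conforming C} = {x. \<exists>c. conf c \<and> x \<^bold>\<in> c}"
      unfolding conf[symmetric] by (auto dest: conforming_in) (use conforming_in in force)
    then show ?thesis unfolding conf_def subset_def by auto
  qed
  ultimately show False using Union_conforming_not_in by simp
qed

section \<open>From a minimal element to a generic filter\<close>

lemma AC_imp_generic:
  assumes AC
  shows generic_filters_exist
  unfolding generic_filters_exist_def
proof (intro allI impI, elim conjE)
  fix P R \<D>
  assume po: "partial_order P R" and "Zorn_order P R" and dense: "\<forall>D. D \<^bold>\<in> \<D> \<longrightarrow> dense P R D"
  then obtain p where p: "minimal P R p" using Zorn_minimal \<open>AC\<close> by blast
  have "definable (\<lambda>s. related R p (s 0))"
    unfolding language_defs by (intro definable_intros)
  from separation_definable[OF this, of P]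
  obtain G where G: "\<And>q. q \<^bold>\<in> G \<longleftrightarrow> q \<^bold>\<in> P \<and> related R p q" by blast
  have p_refl: "p \<^bold>\<in> P" "related R p p"
    using p po unfolding minimal_def partial_order_def by blast+
  have "is_filter P R G"
    unfolding is_filter_def subset_def G using po p_refl unfolding partial_order_def by blast
  \<comment> \<open>Density puts an element of \<open>D\<close> under \<open>p\<close>; by
    minimality it is \<open>p\<close> itself.\<close>
  moreover have "\<exists>q. q \<^bold>\<in> G \<and> q \<^bold>\<in> D" if "D \<^bold>\<in> \<D>" for D
    using dense that p p_refl unfolding dense_def subset_def minimal_def G by metis
  ultimately show "\<exists>G. generic_filter P R \<D> G" unfolding generic_filter_def by blast
qed


section \<open>Generic filters imply choice\<close>

lemma generic_imp_AC:
  assumes gen: generic_filters_exist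
  shows AC
  unfolding AC_def
proof (intro allI impI)
  fix F assume F: "\<forall>X. X \<^bold>\<in> F \<longrightarrow> \<not> is_empty X"
  obtain V where V: "\<And>x. x \<^bold>\<in> V \<longleftrightarrow> (\<exists>y. y \<^bold>\<in> F \<and> x \<^bold>\<in> y)" using Union_ex by blast
  have "definable (\<lambda>s. s 0 \<^bold>\<in> s 1)" by (intro definable_intros)
  then obtain E where E_pair: "\<And>u. u \<^bold>\<in> E \<Longrightarrow> \<exists>X x. X \<^bold>\<in> F \<and> x \<^bold>\<in> V \<and> is_pair u X x"
    and "\<And>X x. related E X x \<longleftrightarrow> X \<^bold>\<in> F \<and> x \<^bold>\<in> V \<and> x \<^bold>\<in> X"
    using relation_ex[of "\<lambda>X x. x \<^bold>\<in> X" F V] by blast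
  then have E: "related E X x \<longleftrightarrow> X \<^bold>\<in> F \<and> x \<^bold>\<in> X" for X x using V by blast
  obtain pwE where pwE: "\<And>p. p \<^bold>\<in> pwE \<longleftrightarrow> subset p E" using Pow_ex by blast
  define good where "good p \<longleftrightarrow> (\<forall>X. X \<^bold>\<in> F \<longrightarrow>
    (\<forall>x. x \<^bold>\<in> X \<longrightarrow> related p X x) \<or> (\<exists>!x. related p X x))" for p
  have "definable (\<lambda>s. good (s 0))"
    unfolding good_def language_defs by (intro definable_intros)
  from separation_definable[OF this, of pwE]
  obtain P where "\<And>p. p \<^bold>\<in> P \<longleftrightarrow> p \<^bold>\<in> pwE \<and> good p" by blast
  then have P: "p \<^bold>\<in> P \<longleftrightarrow> subset p E \<and> good p" for p using pwE by simp
  have "definable (\<lambda>s. subset (s 1) (s 0))"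
    unfolding language_defs by (intro definable_intros)
  then obtain R where R_pair: "\<And>u. u \<^bold>\<in> R \<Longrightarrow> \<exists>p q. p \<^bold>\<in> P \<and> q \<^bold>\<in> P \<and> is_pair u p q"
    and R: "\<And>p q. related R p q \<longleftrightarrow> p \<^bold>\<in> P \<and> q \<^bold>\<in> P \<and> subset p q"
    using relation_ex[of subset P P] by blast
  \<comment> \<open>Elements of \<open>P\<close> contain only pairs, so inclusion can be tested
    fibre by fibre.\<close>
  have subset_related: "subset p q \<longleftrightarrow> (\<forall>X x. related p X x \<longrightarrow> related q X x)"
    if "p \<^bold>\<in> P" for p q
    using that E_pair unfolding P subset_def related_def by (metis pair_unique)
  have P_in: "X \<^bold>\<in> F \<and> x \<^bold>\<in> X" if "p \<^bold>\<in> P" "related p X x" for p X x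
    using that E unfolding P subset_def related_def by blast
  have P_nonempty: "\<exists>x. related p X x" if "p \<^bold>\<in> P" "X \<^bold>\<in> F" for p X
    using that F unfolding P good_def is_empty_def by blast
  have P_cases: "(\<forall>x. x \<^bold>\<in> X \<longrightarrow> related p X x) \<or> (\<exists>!x. related p X x)"
    if "p \<^bold>\<in> P" "X \<^bold>\<in> F" for p X
    using that unfolding P good_def by blast
  have po: "partial_order P R"
    unfolding partial_order_def
  proof (intro conjI)
    show "\<forall>p q. related R p q \<and> related R q p \<longrightarrow> p = q"
      unfolding R subset_def by (blast intro: ext)
  qed (use R_pair R in \<open>auto simp: subset_def\<close>)

  \<comment> \<open>Shrinking one fibre to a chosen point, with the others untouched, serves both
    semi-separativity and density.\<close>
  have restrict: "\<exists>q. q \<^bold>\<in> P \<and> subset q p \<and> (\<forall>y. related q X y \<longleftrightarrow> y = x)"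
    if p: "p \<^bold>\<in> P" and x: "related p X x" for p X x
  proof -
    have "definable (\<lambda>s. \<exists>Y y. is_pair (s 0) Y y \<and> (Y = X \<longrightarrow> y = x))"
      unfolding language_defs by (intro definable_intros)
    from separation_definable[OF this, of p]
    obtain q where q: "\<And>u. u \<^bold>\<in> q \<longleftrightarrow> u \<^bold>\<in> p \<and> (\<exists>Y y. is_pair u Y y \<and> (Y = X \<longrightarrow> y = x))" by blast
    have rel: "related q Y y \<longleftrightarrow> related p Y y \<and> (Y = X \<longrightarrow> y = x)" for Y y
      unfolding related_def q using pair_inject by blast
    have "good q" unfolding good_def rel using P_cases[OF p] x by (metis (full_types))
    moreover have "subset q p" unfolding subset_def q by blast
    ultimately have "q \<^bold>\<in> P" using p unfolding P subset_def by blast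
    then show ?thesis using rel x \<open>subset q p\<close> by blast
  qed
  \<comment> \<open>Pairwise compatibility is assumed so that the result covers both chains and
    filters. The intersection is taken inside \<open>E\<close>, which makes it \<open>E\<close> for
    empty \<open>C\<close>.\<close>
  have meet: "\<exists>m. m \<^bold>\<in> P \<and> (\<forall>p. p \<^bold>\<in> C \<longrightarrow> subset m p)"
    if C: "subset C P"
      and compat: "\<And>p q. p \<^bold>\<in> C \<Longrightarrow> q \<^bold>\<in> C \<Longrightarrow> \<exists>r. r \<^bold>\<in> P \<and> subset r p \<and> subset r q" for C
  proof -
    have "definable (\<lambda>s. \<forall>p. p \<^bold>\<in> C \<longrightarrow> (s 0) \<^bold>\<in> p)"
      by (intro definable_intros)
    from separation_definable[OF this, of E]
    obtain m where m: "\<And>u. u \<^bold>\<in> m \<longleftrightarrow> u \<^bold>\<in> E \<and> (\<forall>p. p \<^bold>\<in> C \<longrightarrow> u \<^bold>\<in> p)" by blast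
    have rel: "related m X x \<longleftrightarrow> related E X x \<and> (\<forall>p. p \<^bold>\<in> C \<longrightarrow> related p X x)" for X x
    proof -
      obtain u where "is_pair u X x" using pair_ex by blast
      then show ?thesis using m by (simp add: related_iff_mem)
    qed
    have "good m"
      unfolding good_def
    proof (intro allI impI)
      fix X assume X: "X \<^bold>\<in> F"
      show "(\<forall>x. x \<^bold>\<in> X \<longrightarrow> related m X x) \<or> (\<exists>!x. related m X x)"
      proof (cases "\<forall>p. p \<^bold>\<in> C \<longrightarrow> (\<forall>x. x \<^bold>\<in> X \<longrightarrow> related p X x)")
        case True
        then show ?thesis unfolding rel E using X by blast
      next
        case False
        then obtain p where p: "p \<^bold>\<in> C" "\<not> (\<forall>x. x \<^bold>\<in> X \<longrightarrow> related p X x)" by blast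
        have pP: "p \<^bold>\<in> P" using C p unfolding subset_def by blast
        then obtain x where x: "\<And>y. related p X y \<longleftrightarrow> y = x" using P_cases X p by metis
        \<comment> \<open>A common extension of \<open>p\<close> and \<open>q\<close> has a nonempty
          fibre inside the singleton fibre of \<open>p\<close>, so \<open>q\<close> contains its
          point too.\<close>
        have "related q X x" if q: "q \<^bold>\<in> C" for q
        proof -
          obtain r where r: "r \<^bold>\<in> P" "subset r p" "subset r q" using compat p q by blast
          then show ?thesis using P_nonempty[OF r(1) X] x subset_related by metis
        qed
        moreover have "related E X x" using x pP P_in X E by blast
        ultimately show ?thesis unfolding rel using x p by metis
      qed
    qed
    then have "m \<^bold>\<in> P" unfolding P subset_def m by blast
    moreover have "subset m p" if "p \<^bold>\<in> C" for p using that unfolding subset_def m by blast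
    ultimately show ?thesis by blast
  qed
  have zorn: "Zorn_order P R"
    unfolding Zorn_order_def
  proof (intro allI impI, elim conjE)
    fix C assume C: "subset C P" "linearly_ordered R C"
    have "\<exists>r. r \<^bold>\<in> P \<and> subset r p \<and> subset r q" if "p \<^bold>\<in> C" "q \<^bold>\<in> C" for p q
    proof -
      have "related R p q \<or> related R q p" using C(2) that unfolding linearly_ordered_def by blast
      moreover have "subset p p" "subset q q" unfolding subset_def by blast+
      ultimately show ?thesis unfolding R by blast
    qed
    then obtain m where "m \<^bold>\<in> P" "\<forall>p. p \<^bold>\<in> C \<longrightarrow> subset m p" using meet[OF C(1)] by blast
    then show "\<exists>b. b \<^bold>\<in> P \<and> (\<forall>c. c \<^bold>\<in> C \<longrightarrow> related R b c)"
      using C(1) unfolding R subset_def by blast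
  qed
  have semi: "semi_separative P R"
    unfolding semi_separative_def
  proof (intro allI impI)
    fix p assume p: "p \<^bold>\<in> P"
    show "minimal P R p \<or> (\<exists>q r. q \<^bold>\<in> P \<and> r \<^bold>\<in> P \<and> related R q p \<and> related R r p \<and>
      \<not> compatible P R q r)"
    proof (cases "minimal P R p")
      case False
      then obtain q where q: "q \<^bold>\<in> P" "subset q p" "q \<noteq> p"
        using p unfolding minimal_def R by blast
      then have "\<not> subset p q" unfolding subset_def by (blast intro: ext)
      \<comment> \<open>A proper extension loses some \<open>a\<close> over some \<open>X\<close>
        but keeps some \<open>b\<close>. Shrinking the fibre of \<open>p\<close> to \<open>a\<close>
        or to \<open>b\<close> gives incompatible extensions, as fibres are never empty.\<close>
      then obtain X a where a: "related p X a" "\<not> related q X a"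
        using subset_related[OF p] by blast
      obtain b where b: "related q X b" using P_nonempty[OF q(1)] P_in[OF p a(1)] by blast
      then have "related p X b" "a \<noteq> b" using q a subset_related by blast+
      obtain qa where qa: "qa \<^bold>\<in> P" "subset qa p" "\<And>y. related qa X y \<longleftrightarrow> y = a"
        using restrict[OF p a(1)] by blast
      obtain qb where qb: "qb \<^bold>\<in> P" "subset qb p" "\<And>y. related qb X y \<longleftrightarrow> y = b"
        using restrict[OF p \<open>related p X b\<close>] by blast
      have "\<not> compatible P R qa qb"
      proof
        assume "compatible P R qa qb"
        then obtain r where r: "r \<^bold>\<in> P" "subset r qa" "subset r qb"
          unfolding compatible_def R by blast
        obtain y where "related r X y" using P_nonempty[OF r(1)] P_in[OF p a(1)] by blast
        then have "y = a" "y = b" using r subset_related qa(3) qb(3) by blast+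
        then show False using \<open>a \<noteq> b\<close> by blast
      qed
      then show ?thesis using qa qb p R by blast
    qed blast
  qed
  obtain pwP where pwP: "\<And>D. D \<^bold>\<in> pwP \<longleftrightarrow> subset D P" using Pow_ex by blast
  \<comment> \<open>Characterizing each dense set by a formula lets Separation on the power set of
    \<open>P\<close> collect the family, instead of Replacement over \<open>F\<close>.\<close>
  define decides where "decides D X \<longleftrightarrow> (\<forall>p. p \<^bold>\<in> D \<longleftrightarrow> p \<^bold>\<in> P \<and> (\<exists>!x. related p X x))" for D X
  have "definable (\<lambda>s. \<exists>X. X \<^bold>\<in> F \<and> decides (s 0) X)"
    unfolding decides_def language_defs by (intro definable_intros)
  from separation_definable[OF this, of pwP]
  obtain \<D> where \<D>: "\<And>D. D \<^bold>\<in> \<D> \<longleftrightarrow> D \<^bold>\<in> pwP \<and> (\<exists>X. X \<^bold>\<in> F \<and> decides D X)" by blast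
  have "dense P R D" if D: "D \<^bold>\<in> \<D>" for D
  proof -
    obtain X where X: "X \<^bold>\<in> F" "decides D X" using D \<D> by blast
    have "\<exists>q. q \<^bold>\<in> D \<and> related R q p" if p: "p \<^bold>\<in> P" for p
    proof -
      obtain x where "related p X x" using P_nonempty[OF p X(1)] by blast
      then obtain q where "q \<^bold>\<in> P" "subset q p" "\<And>y. related q X y \<longleftrightarrow> y = x"
        using restrict[OF p] by blast
      then show ?thesis using X(2) p unfolding decides_def R by auto
    qed
    then show ?thesis using D \<D> pwP unfolding dense_def by blast
  qed
  then obtain G where filter: "is_filter P R G" and G: "\<And>D. D \<^bold>\<in> \<D> \<Longrightarrow> \<exists>p. p \<^bold>\<in> G \<and> p \<^bold>\<in> D"
    using gen po semi zorn unfolding generic_filters_exist_def generic_filter_def by blast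
  have "\<exists>r. r \<^bold>\<in> P \<and> subset r p \<and> subset r q" if "p \<^bold>\<in> G" "q \<^bold>\<in> G" for p q
    using filter that unfolding is_filter_def R by blast
  moreover have "subset G P" using filter unfolding is_filter_def by blast
  ultimately obtain f where f: "f \<^bold>\<in> P" and f_below: "\<And>p. p \<^bold>\<in> G \<Longrightarrow> subset f p"
    using meet by blast
  have "\<exists>!x. related f X x" if X: "X \<^bold>\<in> F" for X
  proof -
    have "definable (\<lambda>s. \<exists>!x. related (s 0) X x)"
      unfolding language_defs by (intro definable_intros)
    from separation_definable[OF this, of P]
    obtain D where D: "\<And>p. p \<^bold>\<in> D \<longleftrightarrow> p \<^bold>\<in> P \<and> (\<exists>!x. related p X x)" by blast
    then have "D \<^bold>\<in> \<D>" using X unfolding \<D> pwP subset_def decides_def by blast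
    then obtain p where "p \<^bold>\<in> G" "\<exists>!x. related p X x" using G D by blast
    \<comment> \<open>The fibre of \<open>f\<close> is nonempty and lies inside the singleton fibre
      of \<open>p\<close>.\<close>
    then show ?thesis using P_nonempty[OF f X] f_below subset_related[OF f] by metis
  qed
  then have "choice_function f F"
    unfolding choice_function_def function_on_def
    using f P_in[OF f] E_pair unfolding P subset_def by blast
  then show "\<exists>f. choice_function f F" by blast
qed

end

theorem theorem2p4:
  fixes mem :: "'v \<Rightarrow> 'v \<Rightarrow> bool"
  assumes "membership_structure.ZF mem"
  shows "membership_structure.AC mem \<longleftrightarrow> membership_structure.generic_filters_exist mem"
proof -
  interpret ZF_structure mem by unfold_locales (rule assms)
  show ?thesis using AC_imp_generic generic_imp_AC by blast
qed

end
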